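(* Let $n\ge 1$ and consider the Ziggu state graph on $n$ digits (defined in the context). The longest solution, i.e. the solution with the most states, has exactly $(3^{n+1}-1)/2$ states and therefore $(3^{n+1}-3)/2$ moves. These quantities equal the number of states, which are the strings $q$ that are states and lie between $0^n$ and $3^n$ in the quaternary reflected Gray code, and the number of moves among them.
   Context: Ziggu state graph on $n$ digits. Write strings over $\{0,1,2,3\}$ as $q=q_nq_{n-1}\cdots q_1$, where $q_1$ is the rightmost digit. A state is such a string in which every digit to the right of a $3$ is also a $3$; that is, for $1\le i<n$, $q_{i+1}=3$ implies $q_i=3$. Two states $q,q'$ are adjacent iff they agree in all positions except one position $i$, where $\{q_i,q'_i\}=\{a,a+1\}$ for some $a\in\{0,1,2\}$, and, if $i\ge2$, the common digit $q_{i-1}$ equals $3$ when $a$ is even and equals $0$ when $a$ is odd. A solution is a sequence of pairwise distinct states from $0^n$ to $3^n$ in which consecutive states are adjacent. Its number of states is the length of the sequence, and its number of moves is one less. The quaternary reflected Gray code $\mathbb{Q}(n)$ is the list defined by $\mathbb{Q}(1)=0,1,2,3$ and, for $n\ge2$, $$\mathbb{Q}(n)=0\cdot\mathbb{Q}(n-1),\ 1\cdot\overleftarrow{\mathbb{Q}(n-1)},\ 2\cdot\mathbb{Q}(n-1),\ 3\cdot\overleftarrow{\mathbb{Q}(n-1)}.$$ Here $d\cdot L$ prefixes the digit $d$ to every string of the list $L$, $\overleftarrow{L}$ is $L$ in reverse order, and commas denote concatenation of lists. *)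

theory Defs
  imports Complex_Main
begin

text \<open>A string \<open>q\<^sub>n \<dots> q\<^sub>1\<close> is the list \<open>[q\<^sub>n, \<dots>, q\<^sub>1]\<close>, so its head is the leftmost digit;
  \<open>digit q i\<close> is \<open>q\<^sub>i\<close>, meaningful for \<open>1 \<le> i \<le> length q\<close>.\<close>

definition digit :: "nat list \<Rightarrow> nat \<Rightarrow> nat" where
  "digit q i = q ! (length q - i)"

definition ziggu_state :: "nat \<Rightarrow> nat list \<Rightarrow> bool" where
  "ziggu_state n q \<longleftrightarrow>
     length q = n \<and> set q \<subseteq> {0, 1, 2, 3} \<and>
     (\<forall>i\<in>{1..<n}. digit q (i + 1) = 3 \<longrightarrow> digit q i = 3)"

definition ziggu_adj :: "nat \<Rightarrow> nat list \<Rightarrow> nat list \<Rightarrow> bool" where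
  "ziggu_adj n q q' \<longleftrightarrow>
     ziggu_state n q \<and> ziggu_state n q' \<and>
     (\<exists>i\<in>{1..n}.
        (\<forall>j\<in>{1..n}. j \<noteq> i \<longrightarrow> digit q j = digit q' j) \<and>
        (\<exists>a\<in>{0, 1, 2}.
           {digit q i, digit q' i} = {a, a + 1} \<and>
           (i \<ge> 2 \<longrightarrow> digit q (i - 1) = (if even a then 3 else 0))))"

definition ziggu_solution :: "nat \<Rightarrow> nat list list \<Rightarrow> bool" where
  "ziggu_solution n L \<longleftrightarrow>
     L \<noteq> [] \<and> hd L = replicate n 0 \<and> last L = replicate n 3 \<and>
     distinct L \<and> (\<forall>q\<in>set L. ziggu_state n q) \<and>
     successively (ziggu_adj n) L"

definition num_states :: "nat list list \<Rightarrow> nat" where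
  "num_states L = length L"

definition num_moves :: "nat list list \<Rightarrow> nat" where
  "num_moves L = length L - 1"

definition longest_solution :: "nat \<Rightarrow> nat list list \<Rightarrow> bool" where
  "longest_solution n L \<longleftrightarrow>
     ziggu_solution n L \<and> (\<forall>M. ziggu_solution n M \<longrightarrow> num_states M \<le> num_states L)"

text \<open>The code is defined from length \<open>1\<close> on; the value at \<open>0\<close> is a dummy.\<close>

fun qgray :: "nat \<Rightarrow> nat list list" where
  "qgray 0 = []"
| "qgray (Suc 0) = [[0], [1], [2], [3]]"
| "qgray (Suc (Suc n)) =
     map ((#) 0) (qgray (Suc n)) @ map ((#) 1) (rev (qgray (Suc n))) @
     map ((#) 2) (qgray (Suc n)) @ map ((#) 3) (rev (qgray (Suc n)))"

definition lies_between :: "'a list \<Rightarrow> 'a \<Rightarrow> 'a \<Rightarrow> 'a \<Rightarrow> bool" where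
  "lies_between L x z y \<longleftrightarrow>
     (\<exists>i j k. i \<le> j \<and> j \<le> k \<and> k < length L \<and> L ! i = x \<and> L ! j = y \<and> L ! k = z)"

definition gray_states :: "nat \<Rightarrow> nat list set" where
  "gray_states n =
     {q. ziggu_state n q \<and> lies_between (qgray n) (replicate n 0) (replicate n 3) q}"

text \<open>The moves among these states in the order of the Gray code: the pairs of states that follow
  one another in the code, after the strings outside \<open>gray_states n\<close> are skipped, and that are
  adjacent in the state graph. Adjacency is required here, not taken for granted.\<close>

definition gray_moves :: "nat \<Rightarrow> (nat list \<times> nat list) set" where
  "gray_moves n =
     (let L = filter (\<lambda>q. q \<in> gray_states n) (qgray n)
      in {(L ! k, L ! Suc k) | k. Suc k < length L \<and> ziggu_adj n (L ! k) (L ! Suc k)})"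

end

theory Submission
  imports Defs
begin

text \<open>A state is a word over \<open>{0,1,2}\<close> followed by a block of 3s, so there are
  \<open>3\<^sup>0 + \<dots> + 3\<^sup>n\<close> states, and no solution is longer than that. Deleting the non-states from the
  Gray code leaves a list that satisfies \<open>Z(n) = 0\<cdot>Z(n-1), 1\<cdot>rev Z(n-1), 2\<cdot>Z(n-1), 3\<^sup>n\<close>: of the
  last block \<open>3\<cdot>rev Q(n-1)\<close> only \<open>3\<^sup>n\<close> survives. As \<open>Z(n-1)\<close> runs from \<open>0\<^sup>n\<^sup>-\<^sup>1\<close> to \<open>3\<^sup>n\<^sup>-\<^sup>1\<close>, the
  leading digit changes from 0 to 1 and from 2 to 3 next to a 3, and from 1 to 2 next to a 0,
  exactly as the rules allow. Hence \<open>Z(n)\<close> is a Hamiltonian path of the state graph.\<close>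

fun ziggu_path :: "nat \<Rightarrow> nat list list" where
  "ziggu_path 0 = [[]]"
| "ziggu_path (Suc n) =
     map ((#) 0) (ziggu_path n) @ map ((#) 1) (rev (ziggu_path n)) @
     map ((#) 2) (ziggu_path n) @ [replicate (Suc n) 3]"

section \<open>Recursive description of states by their leading digit\<close>

lemma digit_Cons: "i \<le> length q \<Longrightarrow> digit (d # q) i = digit q i"
  by (simp add: digit_def Suc_diff_le)

lemma digit_Cons_length: "digit (d # q) (Suc (length q)) = d"
  by (simp add: digit_def)

lemma digit_replicate: "1 \<le> i \<Longrightarrow> i \<le> n \<Longrightarrow> digit (replicate n c) i = c"
  by (simp add: digit_def)

lemma ziggu_state_0: "ziggu_state 0 q \<longleftrightarrow> q = []"
  by (auto simp: ziggu_state_def)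

lemma ziggu_state_replicate_3: "ziggu_state n (replicate n 3)"
  by (auto simp: ziggu_state_def digit_replicate)

text \<open>Positions count from the right, so a new leading digit leaves positions \<open>1\<close>
  to \<open>n\<close> untouched and adds only the instance \<open>i = n\<close> of the state
  condition. The guard \<open>n \<ge> 1\<close> is there because for \<open>n = 0\<close> the range
  of \<open>i\<close> is still empty.\<close>

lemma ziggu_state_Cons_iff_hd:
  "ziggu_state (Suc n) (d # q) \<longleftrightarrow>
     d \<in> {0, 1, 2, 3} \<and> ziggu_state n q \<and> (d = 3 \<longrightarrow> n \<ge> 1 \<longrightarrow> digit q n = 3)"
proof (cases "length q = n")
  case True
  have "(\<forall>i\<in>{1..<Suc n}. digit (d # q) (i + 1) = 3 \<longrightarrow> digit (d # q) i = 3) \<longleftrightarrow>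
        (\<forall>i\<in>{1..<n}. digit (d # q) (i + 1) = 3 \<longrightarrow> digit (d # q) i = 3) \<and>
        (n \<ge> 1 \<longrightarrow> digit (d # q) (Suc n) = 3 \<longrightarrow> digit (d # q) n = 3)"
    by (auto simp: less_Suc_eq)
  also have "\<dots> \<longleftrightarrow> (\<forall>i\<in>{1..<n}. digit q (i + 1) = 3 \<longrightarrow> digit q i = 3) \<and>
        (n \<ge> 1 \<longrightarrow> d = 3 \<longrightarrow> digit q n = 3)"
    using True digit_Cons_length[of d q] by (simp add: digit_Cons)
  finally show ?thesis
    using True by (auto simp: ziggu_state_def)
qed (auto simp: ziggu_state_def)

text \<open>The condition passes a 3 on to its right neighbour, hence by induction to every
  position.\<close>

lemma ziggu_state_leading_3:
  "ziggu_state n q \<Longrightarrow> n \<ge> 1 \<Longrightarrow> digit q n = 3 \<Longrightarrow> q = replicate n 3"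
proof (induction n arbitrary: q)
  case (Suc n)
  then obtain d p where q: "q = d # p" "length p = n"
    by (auto simp: ziggu_state_def length_Suc_conv)
  with Suc.prems have "d = 3" "ziggu_state n p" "n \<ge> 1 \<longrightarrow> digit p n = 3"
    using digit_Cons_length[of d p] by (auto simp: ziggu_state_Cons_iff_hd)
  with Suc.IH[of p] q show ?case by (cases n) auto
qed simp

lemma ziggu_state_Cons:
  "ziggu_state (Suc n) (d # q) \<longleftrightarrow>
     d \<in> {0, 1, 2} \<and> ziggu_state n q \<or> d = 3 \<and> q = replicate n 3"
  using ziggu_state_leading_3[of n q] ziggu_state_replicate_3[of n]
  by (cases n) (auto simp: ziggu_state_Cons_iff_hd ziggu_state_0 digit_def)

section \<open>The path lists every state exactly once\<close>

lemma set_ziggu_path: "set (ziggu_path n) = {q. ziggu_state n q}"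
proof (induction n)
  case 0
  then show ?case by (auto simp: ziggu_state_0)
next
  case (Suc n)
  show ?case
  proof (intro set_eqI)
    fix q
    show "q \<in> set (ziggu_path (Suc n)) \<longleftrightarrow> q \<in> {q. ziggu_state (Suc n) q}"
    proof (cases q)
      case Nil
      then show ?thesis by (auto simp: ziggu_state_def)
    next
      case (Cons d p)
      then show ?thesis by (auto simp: Suc.IH ziggu_state_Cons)
    qed
  qed
qed

lemma distinct_ziggu_path: "distinct (ziggu_path n)"
  by (induction n) (auto simp: distinct_map)

text \<open>The lengths satisfy \<open>z(n+1) = 3 * z(n) + 1\<close> with \<open>z(0) = 1\<close>;
  this form of the geometric sum avoids subtraction and division on the naturals.\<close>

lemma length_ziggu_path: "2 * length (ziggu_path n) + 1 = 3 ^ (n + 1)"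
  by (induction n) auto

lemma ziggu_path_not_Nil: "ziggu_path n \<noteq> []"
  by (cases n) auto

lemma hd_ziggu_path: "hd (ziggu_path n) = replicate n 0"
  by (induction n) (auto simp: ziggu_path_not_Nil hd_map)

lemma last_ziggu_path: "last (ziggu_path n) = replicate n 3"
  by (cases n) auto

section \<open>Adjacency of consecutive states on the path\<close>

lemma ziggu_adj_sym: "ziggu_adj n p q \<Longrightarrow> ziggu_adj n q p"
  unfolding ziggu_adj_def
proof (elim conjE bexE, intro conjI)
  fix i a
  assume i: "i \<in> {1..n}" and eq: "\<forall>j\<in>{1..n}. j \<noteq> i \<longrightarrow> digit p j = digit q j"
    and a: "a \<in> {0, 1, 2}" "{digit p i, digit q i} = {a, a + 1}"
      "i \<ge> 2 \<longrightarrow> digit p (i - 1) = (if even a then 3 else 0)"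
  \<comment> \<open>The rule reads the neighbouring digit from the first state only, but the two
    states agree at \<open>i - 1\<close>, since they differ only at \<open>i\<close>.\<close>
  have "i \<ge> 2 \<longrightarrow> digit q (i - 1) = (if even a then 3 else 0)"
  proof
    assume "i \<ge> 2"
    then have "i - 1 \<in> {1..n}" "i - 1 \<noteq> i" using i by auto
    with eq have "digit p (i - 1) = digit q (i - 1)" by blast
    with a(3) \<open>i \<ge> 2\<close> show "digit q (i - 1) = (if even a then 3 else 0)" by simp
  qed
  moreover have "\<forall>j\<in>{1..n}. j \<noteq> i \<longrightarrow> digit q j = digit p j"
    using eq by metis
  moreover have "{digit q i, digit p i} = {a, a + 1}"
    using a(2) by (simp only: insert_commute)
  ultimately show "\<exists>i\<in>{1..n}. (\<forall>j\<in>{1..n}. j \<noteq> i \<longrightarrow> digit q j = digit p j) \<and>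
     (\<exists>a\<in>{0, 1, 2}. {digit q i, digit p i} = {a, a + 1} \<and>
        (i \<ge> 2 \<longrightarrow> digit q (i - 1) = (if even a then 3 else 0)))"
    using i a(1) by blast
qed

text \<open>The same position \<open>i\<close> and the same \<open>a\<close> witness the longer
  move, because a common leading digit shifts no position. A prefix 3 is excluded: it would leave
  the set of states.\<close>

lemma ziggu_adj_Cons:
  assumes "ziggu_adj n p q" "d \<in> {0, 1, 2}"
  shows "ziggu_adj (Suc n) (d # p) (d # q)"
proof -
  obtain i a where st: "ziggu_state n p" "ziggu_state n q"
    and i: "i \<in> {1..n}" and eq: "\<And>j. j \<in> {1..n} \<Longrightarrow> j \<noteq> i \<Longrightarrow> digit p j = digit q j"
    and a: "a \<in> {0, 1, 2}" "{digit p i, digit q i} = {a, a + 1}"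
      "i \<ge> 2 \<longrightarrow> digit p (i - 1) = (if even a then 3 else 0)"
    using assms(1) unfolding ziggu_adj_def by blast
  from st have len: "length p = n" "length q = n"
    by (auto simp: ziggu_state_def)
  have low: "digit (d # p) j = digit p j" "digit (d # q) j = digit q j" if "j \<le> n" for j
    using that len by (auto simp: digit_Cons)
  have "digit (d # p) j = digit (d # q) j" if "j \<in> {1..Suc n}" "j \<noteq> i" for j
    using that eq[of j] low[of j] digit_Cons_length[of d p] digit_Cons_length[of d q] len
    by (cases "j = Suc n") auto
  moreover have "{digit (d # p) i, digit (d # q) i} = {a, a + 1}"
    using a(2) i low[of i] by simp
  moreover have "i \<ge> 2 \<longrightarrow> digit (d # p) (i - 1) = (if even a then 3 else 0)"
    using a(3) i low(1)[of "i - 1"] by auto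
  moreover have "i \<in> {1..Suc n}" using i by auto
  moreover have "ziggu_state (Suc n) (d # p)" "ziggu_state (Suc n) (d # q)"
    using st assms(2) by (simp_all add: ziggu_state_Cons)
  ultimately show ?thesis
    unfolding ziggu_adj_def using a(1) by blast
qed

lemma ziggu_state_replicate_0: "ziggu_state n (replicate n 0)"
  by (auto simp: ziggu_state_def digit_replicate)

text \<open>These are the moves at the junctions of the blocks: the changed position is
  \<open>n + 1\<close>, and the constant tail supplies the 3 or 0 that the rule wants next to
  it.\<close>

lemma ziggu_adj_leading_digit:
  assumes "d \<in> {0, 1, 2}" and q: "q = replicate n (if even d then 3 else 0)"
  shows "ziggu_adj (Suc n) (d # q) (Suc d # q)"
proof -
  have len: "length q = n" using q by simp
  have "digit (d # q) j = digit (Suc d # q) j" if "j \<in> {1..Suc n}" "j \<noteq> Suc n" for j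
    using that len by (simp add: digit_Cons)
  moreover have "{digit (d # q) (Suc n), digit (Suc d # q) (Suc n)} = {d, d + 1}"
    using digit_Cons_length[of d q] digit_Cons_length[of "Suc d" q] len by simp
  moreover have "Suc n \<ge> 2 \<longrightarrow> digit (d # q) (Suc n - 1) = (if even d then 3 else 0)"
    using q by (simp add: digit_Cons digit_replicate)
  moreover have "ziggu_state (Suc n) (d # q)" "ziggu_state (Suc n) (Suc d # q)"
    using assms ziggu_state_replicate_3[of n] ziggu_state_replicate_0[of n]
    by (auto simp: ziggu_state_Cons)
  moreover have "Suc n \<in> {1..Suc n}" by simp
  ultimately show ?thesis
    unfolding ziggu_adj_def using assms(1) by blast
qed

lemma successively_ziggu_path: "successively (ziggu_adj n) (ziggu_path n)"
proof (induction n)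
  case (Suc n)
  let ?Z = "ziggu_path n"
  \<comment> \<open>Within a block, moves are inherited from the shorter path; the reversed block
    also uses the symmetry of adjacency.\<close>
  have up: "successively (ziggu_adj (Suc n)) (map ((#) d) ?Z)"
    and down: "successively (ziggu_adj (Suc n)) (map ((#) d) (rev ?Z))"
    if "d \<in> {0, 1, 2}" for d
    unfolding successively_map successively_rev
    by (rule successively_mono[OF Suc.IH];
        use that ziggu_adj_Cons ziggu_adj_sym in blast)+
  have "ziggu_adj (Suc n) (0 # replicate n 3) (1 # replicate n 3)"
    "ziggu_adj (Suc n) (1 # replicate n 0) (2 # replicate n 0)"
    "ziggu_adj (Suc n) (2 # replicate n 3) (3 # replicate n 3)"
    using ziggu_adj_leading_digit[of 0 _ n] ziggu_adj_leading_digit[of 1 _ n]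
      ziggu_adj_leading_digit[of 2 _ n]
    by (simp_all flip: numeral_2_eq_2)
  with up[of 0] down[of 1] up[of 2] show ?case
    by (auto simp: successively_append_iff ziggu_path_not_Nil hd_map last_map hd_rev last_rev
        hd_ziggu_path last_ziggu_path)
qed simp

section \<open>Longest solutions\<close>

lemma ziggu_solution_path: "ziggu_solution n (ziggu_path n)"
  by (simp add: ziggu_solution_def ziggu_path_not_Nil hd_ziggu_path last_ziggu_path
      distinct_ziggu_path set_ziggu_path successively_ziggu_path)

lemma ziggu_solution_length_le:
  assumes "ziggu_solution n M"
  shows "length M \<le> length (ziggu_path n)"
proof -
  have "set M \<subseteq> set (ziggu_path n)" "distinct M"
    using assms by (auto simp: ziggu_solution_def set_ziggu_path)
  then show ?thesis
    by (metis List.finite_set card_mono distinct_card distinct_ziggu_path)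
qed

lemma longest_solution_iff:
  "longest_solution n L \<longleftrightarrow> ziggu_solution n L \<and> length L = length (ziggu_path n)"
  using ziggu_solution_path[of n] ziggu_solution_length_le[of n]
  by (auto simp: longest_solution_def num_states_def intro: antisym)

section \<open>The states inside the Gray code\<close>

lemma filter_eq_singleton:
  "distinct xs \<Longrightarrow> x \<in> set xs \<Longrightarrow> filter (\<lambda>y. y = x) xs = [x]"
  by (induction xs) (auto simp: filter_empty_conv)

lemma filter_ziggu_state_qgray:
  "n \<ge> 1 \<Longrightarrow> filter (ziggu_state n) (qgray n) = ziggu_path n"
proof (induction n rule: qgray.induct)
  case 2
  then show ?case by (simp add: ziggu_state_Cons ziggu_state_0)
next
  case (3 n)
  let ?Q = "qgray (Suc n)" and ?t = "replicate (Suc n) (3::nat)"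
  have IH: "filter (ziggu_state (Suc n)) ?Q = ziggu_path (Suc n)"
    using 3 by simp
  have low: "ziggu_state (Suc (Suc n)) \<circ> (#) d = ziggu_state (Suc n)" if "d \<in> {0, 1, 2}" for d
    using that by (auto simp: fun_eq_iff ziggu_state_Cons)
  \<comment> \<open>That \<open>?t\<close> occurs exactly once in the code is read off the path:
    \<open>?t\<close> is a state, so filtering by states first loses no copy of it, and the
    induction hypothesis turns the result into a distinct list.\<close>
  have "filter (\<lambda>q. q = ?t) ?Q = filter (\<lambda>q. q = ?t) (filter (ziggu_state (Suc n)) ?Q)"
    using ziggu_state_replicate_3[of "Suc n"] by (auto intro!: filter_cong simp del: replicate_Suc)
  also have "\<dots> = [?t]"
    unfolding IH
    by (intro filter_eq_singleton distinct_ziggu_path) (simp add: set_ziggu_path)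
  finally have top: "filter (\<lambda>q. q = ?t) ?Q = [?t]" .
  have high: "ziggu_state (Suc (Suc n)) \<circ> (#) 3 = (\<lambda>q. q = ?t)"
    by (auto simp: fun_eq_iff ziggu_state_Cons)
  have "filter (ziggu_state (Suc (Suc n))) (qgray (Suc (Suc n))) =
      map ((#) 0) (ziggu_path (Suc n)) @ map ((#) 1) (rev (ziggu_path (Suc n))) @
      map ((#) 2) (ziggu_path (Suc n)) @ [3 # ?t]"
    by (simp add: filter_map low high IH top rev_filter[symmetric]
        del: ziggu_path.simps replicate_Suc)
  then show ?case by simp
qed simp

lemma lies_between_Cons:
  "lies_between L x z y \<Longrightarrow> lies_between (w # L) x z y"
  unfolding lies_between_def by (metis Suc_le_mono Suc_less_eq length_Cons nth_Cons_Suc)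

text \<open>Applied to the Gray code with \<open>P\<close> the state predicate, whose first and last
  survivors are \<open>0^n\<close> and \<open>3^n\<close>, this places every state between
  them.\<close>

lemma lies_between_hd_last_filter:
  "y \<in> set (filter P L) \<Longrightarrow> lies_between L (hd (filter P L)) (last (filter P L)) y"
proof (induction L)
  case (Cons x L)
  show ?case
  proof (cases "P x \<and> filter P L \<noteq> []")
    case True
    let ?z = "last (filter P L)"
    have "\<exists>j k. j \<le> k \<and> k < length (x # L) \<and> (x # L) ! j = y \<and> (x # L) ! k = ?z"
    proof (cases "y = x")
      \<comment> \<open>Here \<open>y\<close> sits at index 0, so any occurrence of
        \<open>?z\<close> in \<open>L\<close> may serve as the end point.\<close>
      case True
      have "?z \<in> set L" using \<open>P x \<and> filter P L \<noteq> []\<close> last_in_set[of "filter P L"] by auto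
      then obtain k where "k < length L" "L ! k = ?z" by (auto simp: in_set_conv_nth)
      then show ?thesis using True
        by (intro exI[of _ 0] exI[of _ "Suc k"]) auto
    next
      case False
      then have "y \<in> set (filter P L)" using Cons.prems True by auto
      from Cons.IH[OF this] obtain j k where "j \<le> k" "k < length L" "L ! j = y" "L ! k = ?z"
        unfolding lies_between_def by auto
      then show ?thesis by (intro exI[of _ "Suc j"] exI[of _ "Suc k"]) auto
    qed
    then show ?thesis using True unfolding lies_between_def
      by (metis filter.simps(2) last_ConsR le0 list.sel(1) nth_Cons_0)
  next
    case False
    then show ?thesis
    proof (cases "P x")
      \<comment> \<open>Now \<open>x\<close> is the only survivor, hence first, last and
        \<open>y\<close> at once, all at index 0.\<close>
      case True
      then have "filter P L = []" using False by blast
      then show ?thesis using True Cons.prems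
        by (auto simp: lies_between_def intro!: exI[of _ 0])
    next
      case False
      then show ?thesis using Cons by (auto intro: lies_between_Cons)
    qed
  qed
qed simp

lemma gray_states_eq: "n \<ge> 1 \<Longrightarrow> gray_states n = {q. ziggu_state n q}"
  using lies_between_hd_last_filter[of _ "ziggu_state n" "qgray n"]
  by (auto simp: gray_states_def filter_ziggu_state_qgray hd_ziggu_path last_ziggu_path
      set_ziggu_path)

section \<open>Counting the moves\<close>

lemma card_consecutive_pairs:
  assumes "distinct L"
  shows "card {(L ! k, L ! Suc k) | k. Suc k < length L} = length L - 1"
proof -
  have "{(L ! k, L ! Suc k) | k. Suc k < length L} =
      (\<lambda>k. (L ! k, L ! Suc k)) ` {..<length L - 1}"
    by (auto simp: image_iff)
  moreover have "inj_on (\<lambda>k. (L ! k, L ! Suc k)) {..<length L - 1}"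
    using assms by (auto simp: inj_on_def nth_eq_iff_index_eq)
  ultimately show ?thesis by (simp add: card_image)
qed

text \<open>The filtered code is the path, so each consecutive pair in it passes the adjacency
  test.\<close>

lemma gray_moves_eq:
  assumes "n \<ge> 1"
  shows "gray_moves n =
    {(ziggu_path n ! k, ziggu_path n ! Suc k) | k. Suc k < length (ziggu_path n)}"
  using assms successively_ziggu_path[of n]
  by (auto simp: gray_moves_def gray_states_eq filter_ziggu_state_qgray Let_def
      successively_conv_nth)

theorem theorem4p4:
  fixes n :: nat
  assumes "n \<ge> 1"
  shows "(\<exists>L. longest_solution n L) \<and>
    (\<forall>L. longest_solution n L \<longrightarrow>
       real (num_states L) = (3 ^ (n + 1) - 1) / 2 \<and>
       real (num_moves L) = (3 ^ (n + 1) - 3) / 2) \<and>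
    {q. ziggu_state n q} = gray_states n \<and>
    real (card (gray_states n)) = (3 ^ (n + 1) - 1) / 2 \<and>
    real (card (gray_moves n)) = (3 ^ (n + 1) - 3) / 2"
proof -
  let ?Z = "ziggu_path n"
  have "real (2 * length ?Z + 1) = real (3 ^ (n + 1))"
    by (simp only: length_ziggu_path)
  then have states: "real (length ?Z) = (3 ^ (n + 1) - 1) / 2"
    by simp
  \<comment> \<open>This keeps the truncated subtraction in \<open>length ?Z - 1\<close> exact when
    it is cast to the reals.\<close>
  have "length ?Z \<ge> 1"
    using ziggu_path_not_Nil[of n] by (cases ?Z) auto
  then have moves: "real (length ?Z - 1) = (3 ^ (n + 1) - 3) / 2"
    using states by (simp add: of_nat_diff field_simps)
  have "card (gray_states n) = length ?Z"
    using assms distinct_card[OF distinct_ziggu_path, of n]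
    by (simp add: gray_states_eq set_ziggu_path)
  moreover have "card (gray_moves n) = length ?Z - 1"
    using assms by (simp add: gray_moves_eq card_consecutive_pairs distinct_ziggu_path)
  moreover have "longest_solution n ?Z"
    by (simp add: longest_solution_iff ziggu_solution_path)
  ultimately show ?thesis
    using assms states moves
    by (auto simp: longest_solution_iff num_states_def num_moves_def gray_states_eq)
qed

end
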